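(* Let $(\mathcal{X},d)$ be a Polish metric space and let $\varphi\in\mathrm{MI}$. Define $$\mathcal{P}^d_\varphi(\mathcal{X}):=\Big\{\mu\in\mathcal{P}(\mathcal{X}):\exists y\in\mathcal{X}\text{ such that }\int_{\mathcal{X}}\varphi(d(x,y))\,d\mu(x)<+\infty\Big\}.$$ This space does not depend on the choice of the point $y\in\mathcal{X}$. For $\mu_0,\mu_1\in\mathcal{P}^d_\varphi(\mathcal{X})$ define $$\mathrm{W}^d_\varphi(\mu_0,\mu_1):=\varphi^{-1}\Big(\inf_{\gamma\in\Pi(\mu_0,\mu_1)}\int_{\mathcal{X}\times\mathcal{X}}\varphi(d(x_0,x_1))\,d\gamma(x_0,x_1)\Big).$$ Then $\mathrm{W}^d_\varphi$ defines a finite distance on $\mathcal{P}^d_\varphi(\mathcal{X})$.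
   Context: $\mathcal{P}(\mathcal{X})$ is the set of Borel probability measures on $\mathcal{X}$; $\Pi(\mu_0,\mu_1)$ is the set of probability measures on $\mathcal{X}\times\mathcal{X}$ with marginals $\mu_0,\mu_1$. $\mathrm{MI}$ is the set of increasing bijections $\varphi:\mathbb{R}_{\ge0}\to\mathbb{R}_{\ge0}$ such that $F_\varphi(x_0,x_1):=\varphi(\varphi^{-1}(x_0)+\varphi^{-1}(x_1))$ is concave on $\mathbb{R}_{\ge0}^2$. *)

theory Defs
  imports "HOL-Probability.Probability"
begin

definition F_of :: "(real \<Rightarrow> real) \<Rightarrow> real \<times> real \<Rightarrow> real" where
  "F_of \<phi> = (\<lambda>(x0, x1). \<phi> (inv_into {0..} \<phi> x0 + inv_into {0..} \<phi> x1))"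

text \<open>A map of the nonnegative half-line is represented by a total function on the reals
  of which only the restriction to \<open>{0..}\<close> matters.\<close>

definition MI :: "(real \<Rightarrow> real) set" where
  "MI = {\<phi>. bij_betw \<phi> {0..} {0..} \<and> strict_mono_on {0..} \<phi> \<and>
             concave_on ({0..} \<times> {0..}) (F_of \<phi>)}"

definition borel_probs :: "'a::topological_space measure set" where
  "borel_probs = {\<mu>. prob_space \<mu> \<and> sets \<mu> = sets borel}"

definition couplings ::
  "'a::topological_space measure \<Rightarrow> 'a measure \<Rightarrow> ('a \<times> 'a) measure set" where
  "couplings \<mu>0 \<mu>1 = {\<gamma> \<in> borel_probs. distr \<gamma> borel fst = \<mu>0 \<and> distr \<gamma> borel snd = \<mu>1}"

definition P_phi :: "(real \<Rightarrow> real) \<Rightarrow> 'a::polish_space measure set" where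
  "P_phi \<phi> = {\<mu> \<in> borel_probs. \<exists>y. (\<integral>\<^sup>+ x. ennreal (\<phi> (dist x y)) \<partial>\<mu>) < \<infinity>}"

text \<open>The inverse of \<open>\<phi>\<close> on extended nonnegative reals, with value \<open>\<infinity>\<close> at \<open>\<infinity>\<close>; this way
  finiteness of the transport cost is a claim to be proved and not built into the codomain.\<close>

definition phi_inv :: "(real \<Rightarrow> real) \<Rightarrow> ennreal \<Rightarrow> ennreal" where
  "phi_inv \<phi> t = (if t = \<infinity> then \<infinity> else ennreal (inv_into {0..} \<phi> (enn2real t)))"

definition W_phi ::
  "(real \<Rightarrow> real) \<Rightarrow> 'a::polish_space measure \<Rightarrow> 'a measure \<Rightarrow> ennreal" where
  "W_phi \<phi> \<mu>0 \<mu>1 =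
     phi_inv \<phi> (INF \<gamma> \<in> couplings \<mu>0 \<mu>1. \<integral>\<^sup>+ (x0, x1). ennreal (\<phi> (dist x0 x1)) \<partial>\<gamma>)"

end

theory Submission
  imports Defs
begin

text \<open>
  The whole proof rests on a Minkowski inequality. Write \<open>N f = \<phi>\<inverse> (\<integral> \<phi> \<circ> f)\<close> for a nonnegative
  random variable \<open>f\<close>. As \<open>\<phi> (f + g) = F (\<phi> f, \<phi> g)\<close> with \<open>F\<close> concave, Jensen's inequality for \<open>F\<close>
  says that \<open>N (f + g) \<le> N f + N g\<close> (\<open>MI_Minkowski\<close>). On a single measure this shows that
  integrability of \<open>\<phi> (d (\<cdot>, y))\<close> does not depend on the base point \<open>y\<close>, and on a product
  measure it shows that the independent coupling has finite cost.

  For the triangle inequality one would like to glue a coupling of \<open>\<mu>0, \<mu>1\<close> and a coupling of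
  \<open>\<mu>1, \<mu>2\<close> along their common marginal, which requires disintegration. Since the transport
  cost is an infimum, an approximate gluing is enough: cut the space into countably many Borel
  cells of diameter less than \<open>\<epsilon>\<close> and make the two couplings conditionally independent given the
  cell of the middle point. The two middle points then no longer agree, but their distance is less
  than \<open>\<epsilon>\<close>, and this joint law is given by an explicit density with respect to the product measure
  (\<open>couple_along_countable_label\<close>). Minkowski's inequality applied to the three terms
  \<open>d (x0, x1) + \<epsilon> + d (x1', x2)\<close> yields \<open>W \<mu>0 \<mu>2 \<le> W \<mu>0 \<mu>1 + \<epsilon> + W \<mu>1 \<mu>2\<close>
  (\<open>couplings_compose_approx\<close>).

  Finally, if the distance of \<open>\<mu>\<close> and \<open>\<nu>\<close> vanishes, Markov's inequality provides, for each \<open>r > 0\<close>,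
  a coupling that moves points by at least \<open>r\<close> with probability at most \<open>r\<close>. So \<open>\<mu> C\<close> is at most the
  \<open>\<nu>\<close>-measure of the \<open>r\<close>-neighbourhood of \<open>C\<close>, up to an error \<open>r\<close>; letting \<open>r\<close> tend to \<open>0\<close> gives
  \<open>\<mu> C \<le> \<nu> C\<close> for closed \<open>C\<close>. By symmetry \<open>\<mu>\<close> and \<open>\<nu>\<close> agree on closed sets, hence everywhere.
\<close>

section \<open>Supporting planes of concave functions on the quadrant\<close>

text \<open>A supporting plane exists at each interior point \<open>(p, q)\<close> because the point \<open>((p, q), F (p, q))\<close>
  can be separated from the strict hypograph; the separating hyperplane is not vertical because
  \<open>(p, q)\<close> is interior, and its slopes are nonnegative because \<open>F\<close> is monotone. The nonnegative
  slopes are what allows a bound on the means of the two arguments to be inserted into the plane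
  when Jensen's inequality is derived from it.\<close>

lemma concave_quadrant_supporting_plane:
  fixes F :: "real \<times> real \<Rightarrow> real"
  assumes conc: "concave_on ({0..} \<times> {0..}) F"
    and mono: "\<And>x y x' y'. 0 \<le> x \<Longrightarrow> x \<le> x' \<Longrightarrow> 0 \<le> y \<Longrightarrow> y \<le> y' \<Longrightarrow> F (x, y) \<le> F (x', y')"
    and pos: "p > 0" "q > 0"
  shows "\<exists>u\<ge>0. \<exists>v\<ge>0. \<forall>x\<ge>0. \<forall>y\<ge>0. F (x, y) \<le> F (p, q) + u * (x - p) + v * (y - q)"
proof -
  define S where "S = {z :: (real \<times> real) \<times> real. fst z \<in> {0..} \<times> {0..} \<and> snd z < F (fst z)}"
  have "convex S"
  proof (rule convexI)
    fix a b :: "(real \<times> real) \<times> real" and u v :: real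
    assume a: "a \<in> S" and b: "b \<in> S" and uv: "0 \<le> u" "0 \<le> v" "u + v = 1"
    have Q: "convex ({0..} \<times> {0..} :: (real \<times> real) set)"
      by (intro convex_Times convex_real_interval)
    have in_Q: "u *\<^sub>R fst a + v *\<^sub>R fst b \<in> {0..} \<times> {0..}"
      using convexD[OF Q _ _ uv] a b by (auto simp: S_def)
    have "u * snd a + v * snd b < u * F (fst a) + v * F (fst b)"
    proof (cases "u = 0")
      case True
      then show ?thesis using uv b by (simp add: S_def)
    next
      case False
      then have "u * snd a < u * F (fst a)" using uv a by (simp add: S_def)
      moreover have "v * snd b \<le> v * F (fst b)"
        using uv b by (intro mult_left_mono) (auto simp: S_def)
      ultimately show ?thesis by linarith
    qed
    also have "\<dots> \<le> F (u *\<^sub>R fst a + v *\<^sub>R fst b)"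
      using conc a b uv by (auto simp: concave_on_iff S_def)
    finally show "u *\<^sub>R a + v *\<^sub>R b \<in> S" using in_Q by (simp add: S_def)
  qed
  moreover have "((1, 1), F (1, 1) - 1) \<in> S" by (simp add: S_def)
  moreover have "S \<inter> {((p, q), F (p, q))} = {}" by (simp add: S_def)
  ultimately have "\<exists>w k. w \<noteq> 0 \<and> (\<forall>z\<in>S. inner w z \<le> k) \<and> (\<forall>z\<in>{((p, q), F (p, q))}. k \<le> inner w z)"
    by (intro separating_hyperplane_sets) auto
  then obtain w k where "w \<noteq> 0" and w: "\<forall>z\<in>S. inner w z \<le> k"
    and k: "\<forall>z\<in>{((p, q), F (p, q))}. k \<le> inner w z"
    by blast
  obtain m n c where [simp]: "w = ((m, n), c)" by (metis surj_pair)
  have below: "m * (x - p) + n * (y - q) + c * (t - F (p, q)) \<le> 0"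
    if "x \<ge> 0" "y \<ge> 0" "t < F (x, y)" for x y t
    using bspec[OF w, of "((x, y), t)"] k that by (simp add: S_def algebra_simps)
  have c_nonneg: "c \<ge> 0"
    using below[of p q "F (p, q) - 1"] pos by simp
  have graph: "m * (x - p) + n * (y - q) + c * (F (x, y) - F (p, q)) \<le> 0"
    if "x \<ge> 0" "y \<ge> 0" for x y
  proof (rule field_le_epsilon)
    fix e :: real assume "e > 0"
    \<comment> \<open>The denominator is \<open>c + 1\<close> rather than \<open>c\<close> since \<open>c = 0\<close> is excluded only afterwards.\<close>
    have "m * (x - p) + n * (y - q) + c * ((F (x, y) - e / (c + 1)) - F (p, q)) \<le> 0"
      by (rule below) (use that \<open>e > 0\<close> c_nonneg in auto)
    moreover have "c * (e / (c + 1)) \<le> e"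
      using \<open>e > 0\<close> c_nonneg by (simp add: field_simps)
    ultimately show "m * (x - p) + n * (y - q) + c * (F (x, y) - F (p, q)) \<le> 0 + e"
      by (simp add: algebra_simps)
  qed
  have "c \<noteq> 0"
  proof
    assume "c = 0"
    then have "m = 0" "n = 0"
      using graph[of "p + 1" q] graph[of 0 q] graph[of p "q + 1"] graph[of p 0] pos
      by (auto simp: mult_le_0_iff zero_le_mult_iff)
    with \<open>c = 0\<close> \<open>w \<noteq> 0\<close> show False by (simp add: zero_prod_def)
  qed
  with c_nonneg have "c > 0" by simp
  have "m \<le> 0" "n \<le> 0"
  proof -
    have "0 \<le> c * (F (p + 1, q) - F (p, q))" "0 \<le> c * (F (p, q + 1) - F (p, q))"
      using mono[of p "p + 1" q q] mono[of p p q "q + 1"] pos c_nonneg by auto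
    then show "m \<le> 0" "n \<le> 0"
      using graph[of "p + 1" q] graph[of p "q + 1"] pos by auto
  qed
  have "F (x, y) \<le> F (p, q) + - m / c * (x - p) + - n / c * (y - q)" if "0 \<le> x" "0 \<le> y" for x y
  proof -
    have "F (x, y) - F (p, q) \<le> - (m * (x - p) + n * (y - q)) / c"
      using graph[OF that] \<open>c > 0\<close> by (simp add: pos_le_divide_eq mult.commute)
    also have "\<dots> = - m / c * (x - p) + - n / c * (y - q)"
      by (simp add: add_divide_distrib diff_divide_distrib)
    finally show ?thesis by simp
  qed
  moreover have "0 \<le> - m / c" "0 \<le> - n / c"
    using \<open>m \<le> 0\<close> \<open>n \<le> 0\<close> \<open>c > 0\<close> by (simp_all add: divide_nonpos_pos)
  ultimately show ?thesis by blast
qed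

section \<open>Functions in MI\<close>

lemma MI_inv_into:
  assumes "\<phi> \<in> MI" "x \<ge> 0"
  shows "inv_into {0..} \<phi> (\<phi> x) = x" "inv_into {0..} \<phi> x \<ge> 0" "\<phi> (inv_into {0..} \<phi> x) = x"
proof -
  have b: "bij_betw \<phi> {0..} {0..}" using assms by (simp add: MI_def)
  show "inv_into {0..} \<phi> (\<phi> x) = x" by (rule bij_betw_inv_into_left[OF b]) (use assms in auto)
  show "inv_into {0..} \<phi> x \<ge> 0" "\<phi> (inv_into {0..} \<phi> x) = x"
    using bij_betw_inv_into_right[OF b, of x] bij_betw_apply[OF bij_betw_inv_into[OF b], of x] assms
    by auto
qed

lemma MI_less_iff:
  assumes "\<phi> \<in> MI" "x \<ge> 0" "y \<ge> 0"
  shows "\<phi> x < \<phi> y \<longleftrightarrow> x < y"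
  using assms by (auto simp: MI_def strict_mono_on_less)

lemma MI_le_iff:
  assumes "\<phi> \<in> MI" "x \<ge> 0" "y \<ge> 0"
  shows "\<phi> x \<le> \<phi> y \<longleftrightarrow> x \<le> y"
  using MI_less_iff[OF assms(1,3,2)] by (simp add: linorder_not_less[symmetric])

lemma MI_nonneg: "\<phi> \<in> MI \<Longrightarrow> x \<ge> 0 \<Longrightarrow> \<phi> x \<ge> 0"
  by (auto simp: MI_def dest: bij_betw_apply)

lemma MI_0: "\<phi> \<in> MI \<Longrightarrow> \<phi> 0 = 0"
  using MI_le_iff[of \<phi> 0 "inv_into {0..} \<phi> 0"] MI_inv_into[of \<phi> 0] MI_nonneg[of \<phi> 0] by simp

lemma MI_pos: "\<phi> \<in> MI \<Longrightarrow> x > 0 \<Longrightarrow> \<phi> x > 0"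
  using MI_less_iff[of \<phi> 0 x] by (simp add: MI_0)

lemma MI_measurable:
  assumes "\<phi> \<in> MI" and [measurable]: "f \<in> borel_measurable M" and "\<And>x. f x \<ge> 0"
  shows "(\<lambda>x. \<phi> (f x)) \<in> borel_measurable M"
proof -
  have "mono (\<lambda>x. \<phi> (max 0 x))"
    using MI_le_iff[OF assms(1)] by (intro monoI) auto
  from borel_measurable_mono[OF this] have "(\<lambda>x. \<phi> (max 0 (f x))) \<in> borel_measurable M"
    by measurable
  with assms(3) show ?thesis by (simp add: max_absorb2)
qed

section \<open>The Minkowski inequality\<close>

text \<open>The supporting plane of \<open>F\<close> at \<open>(\<phi> s, \<phi> t)\<close>, pulled back along \<open>\<phi>\<close> and arranged so that only
  nonnegative terms occur; in this form it can be integrated in the extended nonnegative reals.\<close>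

lemma MI_support:
  assumes \<phi>: "\<phi> \<in> MI" and "s > 0" "t > 0"
  shows "\<exists>u\<ge>0. \<exists>v\<ge>0. \<forall>x\<ge>0. \<forall>y\<ge>0. \<phi> (x + y) + u * \<phi> s + v * \<phi> t \<le> \<phi> (s + t) + u * \<phi> x + v * \<phi> y"
proof -
  have F: "F_of \<phi> (\<phi> x, \<phi> y) = \<phi> (x + y)" if "x \<ge> 0" "y \<ge> 0" for x y
    using that MI_inv_into[OF \<phi>] by (simp add: F_of_def)
  have inv_mono: "inv_into {0..} \<phi> x \<le> inv_into {0..} \<phi> y" if "0 \<le> x" "x \<le> y" for x y
    using that MI_le_iff[OF \<phi>, of "inv_into {0..} \<phi> x" "inv_into {0..} \<phi> y"] MI_inv_into[OF \<phi>]
    by auto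
  have "F_of \<phi> (x, y) \<le> F_of \<phi> (x', y')" if "0 \<le> x" "x \<le> x'" "0 \<le> y" "y \<le> y'" for x y x' y'
    using that MI_inv_into[OF \<phi>] inv_mono
    by (auto simp: F_of_def MI_le_iff[OF \<phi>] intro!: add_mono)
  then obtain u v where "u \<ge> 0" "v \<ge> 0"
    and uv: "\<And>x y. x \<ge> 0 \<Longrightarrow> y \<ge> 0 \<Longrightarrow>
      F_of \<phi> (x, y) \<le> F_of \<phi> (\<phi> s, \<phi> t) + u * (x - \<phi> s) + v * (y - \<phi> t)"
    using concave_quadrant_supporting_plane[of "F_of \<phi>" "\<phi> s" "\<phi> t"] \<phi> MI_pos[OF \<phi>] assms(2,3)
    by (auto simp: MI_def)
  have "\<phi> (x + y) + u * \<phi> s + v * \<phi> t \<le> \<phi> (s + t) + u * \<phi> x + v * \<phi> y"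
    if "x \<ge> 0" "y \<ge> 0" for x y
    using uv[of "\<phi> x" "\<phi> y"] that assms(2,3) MI_nonneg[OF \<phi>] by (simp add: F algebra_simps)
  with \<open>u \<ge> 0\<close> \<open>v \<ge> 0\<close> show ?thesis by blast
qed

text \<open>Jensen's inequality for \<open>F\<close>: integrate the supporting plane at \<open>(\<phi> s, \<phi> t)\<close>. Bounding the two
  integrals by \<open>\<phi> s\<close> and \<open>\<phi> t\<close> with \<open>s\<close> and \<open>t\<close> positive, instead of naming their exact values,
  keeps the point of support in the interior of the quadrant even if an integral vanishes.\<close>

lemma (in prob_space) MI_Minkowski:
  assumes \<phi>: "\<phi> \<in> MI" and s: "s > 0" and t: "t > 0"
    and f[measurable]: "f \<in> borel_measurable M" and f0: "\<And>x. f x \<ge> 0"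
    and g[measurable]: "g \<in> borel_measurable M" and g0: "\<And>x. g x \<ge> 0"
    and fs: "(\<integral>\<^sup>+x. ennreal (\<phi> (f x)) \<partial>M) \<le> ennreal (\<phi> s)"
    and gt: "(\<integral>\<^sup>+x. ennreal (\<phi> (g x)) \<partial>M) \<le> ennreal (\<phi> t)"
  shows "(\<integral>\<^sup>+x. ennreal (\<phi> (f x + g x)) \<partial>M) \<le> ennreal (\<phi> (s + t))"
proof -
  note [measurable] = MI_measurable[OF \<phi> f f0] MI_measurable[OF \<phi> g g0]
  have [measurable]: "(\<lambda>x. \<phi> (f x + g x)) \<in> borel_measurable M"
    using MI_measurable[OF \<phi>, of "\<lambda>x. f x + g x" M] f0 g0 by simp
  note nonneg = MI_nonneg[OF \<phi>]
  obtain u v where u: "u \<ge> 0" and v: "v \<ge> 0"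
    and uv: "\<And>x y. x \<ge> 0 \<Longrightarrow> y \<ge> 0 \<Longrightarrow>
      \<phi> (x + y) + u * \<phi> s + v * \<phi> t \<le> \<phi> (s + t) + u * \<phi> x + v * \<phi> y"
    using MI_support[OF \<phi> s t] by blast
  define k where "k = u * \<phi> s + v * \<phi> t"
  have k: "k \<ge> 0" using u v nonneg s t by (simp add: k_def)
  have "(\<integral>\<^sup>+x. ennreal (\<phi> (f x + g x)) \<partial>M) + ennreal k = (\<integral>\<^sup>+x. ennreal (\<phi> (f x + g x)) + ennreal k \<partial>M)"
    by (simp add: nn_integral_add emeasure_space_1)
  also have "\<dots> \<le> (\<integral>\<^sup>+x. ennreal (\<phi> (s + t)) + (ennreal u * ennreal (\<phi> (f x)) + ennreal v * ennreal (\<phi> (g x))) \<partial>M)"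
  proof (rule nn_integral_mono)
    fix x
    have "\<phi> (f x + g x) + k \<le> \<phi> (s + t) + (u * \<phi> (f x) + v * \<phi> (g x))"
      using uv[OF f0 g0] by (simp add: k_def algebra_simps)
    then show "ennreal (\<phi> (f x + g x)) + ennreal k
        \<le> ennreal (\<phi> (s + t)) + (ennreal u * ennreal (\<phi> (f x)) + ennreal v * ennreal (\<phi> (g x)))"
      using nonneg f0 g0 u v k s t
      by (simp add: ennreal_mult[symmetric] ennreal_plus[symmetric] del: ennreal_plus)
  qed
  also have "\<dots> = ennreal (\<phi> (s + t)) + (ennreal u * (\<integral>\<^sup>+x. ennreal (\<phi> (f x)) \<partial>M) + ennreal v * (\<integral>\<^sup>+x. ennreal (\<phi> (g x)) \<partial>M))"
    by (simp add: nn_integral_add nn_integral_cmult emeasure_space_1)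
  also have "\<dots> \<le> ennreal (\<phi> (s + t)) + (ennreal u * ennreal (\<phi> s) + ennreal v * ennreal (\<phi> t))"
    by (intro add_mono mult_left_mono fs gt) auto
  also have "\<dots> = ennreal (\<phi> (s + t)) + ennreal k"
    using nonneg s t u v by (simp add: k_def ennreal_mult)
  finally show ?thesis by (simp add: ennreal_add_left_cancel_le add.commute[of _ "ennreal k"])
qed

section \<open>Coupling along a countable label\<close>

lemma AE_label_positive:
  fixes k :: "'a \<Rightarrow> 'i::countable"
  assumes [measurable]: "k \<in> M \<rightarrow>\<^sub>M count_space UNIV"
  shows "AE x in M. emeasure M {x' \<in> space M. k x' = k x} \<noteq> 0"
proof -
  let ?p = "\<lambda>i. emeasure M {x' \<in> space M. k x' = i}"
  have "AE x in M. \<forall>i. ?p i = 0 \<longrightarrow> k x \<noteq> i"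
    unfolding AE_all_countable
  proof
    fix i show "AE x in M. ?p i = 0 \<longrightarrow> k x \<noteq> i"
      by (cases "?p i = 0") (auto intro!: AE_I[where N="{x' \<in> space M. k x' = i}"])
  qed
  then show ?thesis by eventually_elim auto
qed

text \<open>Two random variables with the same countable-valued label can be made to share it by choosing
  the label first and then drawing both conditionally on it, independently of each other. Relative
  to the product measure this law has density \<open>1 / p i\<close> where both labels equal \<open>i\<close> and \<open>0\<close> where
  they differ, \<open>p\<close> being the common law of the labels. Integrating out one variable gives
  \<open>p i / p i = 1\<close>, so the marginals are preserved.\<close>

lemma couple_along_countable_label:
  fixes k :: "'a \<Rightarrow> 'i::countable" and l :: "'b \<Rightarrow> 'i"
  assumes "prob_space M" "prob_space N"
    and k[measurable]: "k \<in> M \<rightarrow>\<^sub>M count_space UNIV" and l[measurable]: "l \<in> N \<rightarrow>\<^sub>M count_space UNIV"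
    and same: "\<And>i. emeasure M {x \<in> space M. k x = i} = emeasure N {y \<in> space N. l y = i}"
  shows "\<exists>P. prob_space P \<and> sets P = sets (M \<Otimes>\<^sub>M N) \<and> distr P M fst = M \<and> distr P N snd = N
           \<and> (AE z in P. k (fst z) = l (snd z))"
proof -
  interpret M: prob_space M by fact
  interpret N: prob_space N by fact
  interpret pair_sigma_finite M N ..
  define p where "p i = emeasure M {x \<in> space M. k x = i}" for i
  have p_less_top: "p i < \<top>" for i
    by (simp add: p_def less_top[symmetric])
  \<comment> \<open>For \<open>p i = 0\<close> the quotient \<open>1 / p i\<close> is infinite, but such labels occur on a null set only.\<close>
  define w where "w z = (if k (fst z) = l (snd z) then 1 / p (k (fst z)) else 0)" for z
  have w[measurable]: "w \<in> borel_measurable (M \<Otimes>\<^sub>M N)"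
    unfolding w_def by measurable
  define P where "P = density (M \<Otimes>\<^sub>M N) w"
  have setsP[measurable_cong]: "sets P = sets (M \<Otimes>\<^sub>M N)" by (simp add: P_def)
  have p_nz: "AE x in M. p (k x) \<noteq> 0"
    using AE_label_positive[OF k] by (simp add: p_def)
  have p_nz': "AE y in N. p (l y) \<noteq> 0"
    using AE_label_positive[OF l] by (simp add: p_def same)
  have cancel: "1 / p i * p i = 1" if "p i \<noteq> 0" for i
    using that p_less_top[of i] by (simp add: ennreal_divide_times ennreal_divide_self)
  have intN: "(\<integral>\<^sup>+y. w (x, y) \<partial>N) = 1" if "x \<in> space M" "p (k x) \<noteq> 0" for x
  proof -
    have "(\<integral>\<^sup>+y. w (x, y) \<partial>N) = (\<integral>\<^sup>+y. 1 / p (k x) * indicator {y \<in> space N. l y = k x} y \<partial>N)"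
      by (intro nn_integral_cong) (auto simp: w_def)
    also have "\<dots> = 1 / p (k x) * p (k x)"
      by (subst nn_integral_cmult_indicator) (auto simp: p_def same)
    finally show ?thesis using cancel that by simp
  qed
  have intM: "(\<integral>\<^sup>+x. w (x, y) \<partial>M) = 1" if "y \<in> space N" "p (l y) \<noteq> 0" for y
  proof -
    have "(\<integral>\<^sup>+x. w (x, y) \<partial>M) = (\<integral>\<^sup>+x. 1 / p (l y) * indicator {x \<in> space M. k x = l y} x \<partial>M)"
      by (intro nn_integral_cong) (auto simp: w_def)
    also have "\<dots> = 1 / p (l y) * p (l y)"
      by (subst nn_integral_cmult_indicator) (auto simp: p_def)
    finally show ?thesis using cancel that by simp
  qed
  have fst: "distr P M fst = M"
  proof (rule measure_eqI)
    fix A assume "A \<in> sets (distr P M fst)"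
    then have [measurable]: "A \<in> sets M" by simp
    have "emeasure (distr P M fst) A = (\<integral>\<^sup>+z. indicator A (fst z) \<partial>P)"
      by (subst nn_integral_distr[of fst P M "indicator A", symmetric]) auto
    also have "\<dots> = (\<integral>\<^sup>+z. w z * indicator A (fst z) \<partial>(M \<Otimes>\<^sub>M N))"
      unfolding P_def by (subst nn_integral_density) auto
    also have "\<dots> = (\<integral>\<^sup>+x. (\<integral>\<^sup>+y. w (x, y) * indicator A x \<partial>N) \<partial>M)"
      by (subst N.nn_integral_fst[symmetric]) auto
    also have "\<dots> = (\<integral>\<^sup>+x. (\<integral>\<^sup>+y. w (x, y) \<partial>N) * indicator A x \<partial>M)"
      by (intro nn_integral_cong nn_integral_multc) auto
    also have "\<dots> = (\<integral>\<^sup>+x. indicator A x \<partial>M)"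
      by (intro nn_integral_cong_AE, use p_nz AE_space in eventually_elim) (simp add: intN)
    finally show "emeasure (distr P M fst) A = emeasure M A" by simp
  qed simp
  have snd: "distr P N snd = N"
  proof (rule measure_eqI)
    fix A assume "A \<in> sets (distr P N snd)"
    then have [measurable]: "A \<in> sets N" by simp
    have "emeasure (distr P N snd) A = (\<integral>\<^sup>+z. indicator A (snd z) \<partial>P)"
      by (subst nn_integral_distr[of snd P N "indicator A", symmetric]) auto
    also have "\<dots> = (\<integral>\<^sup>+z. w z * indicator A (snd z) \<partial>(M \<Otimes>\<^sub>M N))"
      unfolding P_def by (subst nn_integral_density) auto
    also have "\<dots> = (\<integral>\<^sup>+y. (\<integral>\<^sup>+x. w (x, y) * indicator A y \<partial>M) \<partial>N)"
      by (subst nn_integral_snd[symmetric]) auto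
    also have "\<dots> = (\<integral>\<^sup>+y. (\<integral>\<^sup>+x. w (x, y) \<partial>M) * indicator A y \<partial>N)"
      by (intro nn_integral_cong nn_integral_multc) auto
    also have "\<dots> = (\<integral>\<^sup>+y. indicator A y \<partial>N)"
      by (intro nn_integral_cong_AE, use p_nz' AE_space in eventually_elim) (simp add: intM)
    finally show "emeasure (distr P N snd) A = emeasure N A" by simp
  qed simp
  have "prob_space P"
    by (rule prob_space_distrD[of fst P M]) (simp_all add: fst \<open>prob_space M\<close>)
  moreover have "AE z in P. k (fst z) = l (snd z)"
    unfolding P_def by (subst AE_density) (auto simp: w_def)
  ultimately show ?thesis using setsP fst snd by blast
qed

text \<open>The label sends a point to the first element of a dense sequence within distance \<open>\<epsilon> / 2\<close>.\<close>

lemma small_cells_exist: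
  assumes "\<epsilon> > 0"
  shows "\<exists>k :: 'a::{metric_space, second_countable_topology} \<Rightarrow> nat.
           k \<in> borel \<rightarrow>\<^sub>M count_space UNIV \<and> (\<forall>x y. k x = k y \<longrightarrow> dist x y < \<epsilon>)"
proof -
  obtain D :: "'a set" where D: "countable D" "\<And>X. open X \<Longrightarrow> X \<noteq> {} \<Longrightarrow> \<exists>d\<in>D. d \<in> X"
    using countable_dense_setE by blast
  define e where "e = from_nat_into D"
  have near: "\<exists>n. dist x (e n) < \<epsilon> / 2" for x
  proof -
    obtain d where "d \<in> D" "dist x d < \<epsilon> / 2"
      using D(2)[of "ball x (\<epsilon> / 2)"] assms by auto
    then show ?thesis using from_nat_into_surj[OF D(1)] by (metis e_def)
  qed
  define k where "k x = (LEAST n. dist x (e n) < \<epsilon> / 2)" for x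
  have k: "dist x (e (k x)) < \<epsilon> / 2" for x
    unfolding k_def by (rule LeastI_ex[OF near])
  have "k \<in> borel \<rightarrow>\<^sub>M count_space UNIV"
    unfolding k_def by measurable
  moreover have "dist x y < \<epsilon>" if "k x = k y" for x y
    using k[of x] k[of y] that dist_triangle2[of x y "e (k x)"] by simp
  ultimately show ?thesis by blast
qed

section \<open>Transport costs and couplings\<close>

definition phi_cost :: "(real \<Rightarrow> real) \<Rightarrow> ('a::metric_space \<times> 'a) measure \<Rightarrow> ennreal" where
  "phi_cost \<phi> \<gamma> = (\<integral>\<^sup>+z. ennreal (\<phi> (dist (fst z) (snd z))) \<partial>\<gamma>)"

lemma W_phi_altdef: "W_phi \<phi> \<mu> \<nu> = phi_inv \<phi> (INF \<gamma>\<in>couplings \<mu> \<nu>. phi_cost \<phi> \<gamma>)"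
  by (simp add: W_phi_def phi_cost_def case_prod_unfold)

text \<open>This lemma and the next one translate bounds on the transport distance into bounds on the cost
  of single couplings, so that the infimum need not be handled any further.\<close>

lemma W_phi_le:
  assumes \<phi>: "\<phi> \<in> MI" and "\<gamma> \<in> couplings \<mu> \<nu>" "phi_cost \<phi> \<gamma> \<le> ennreal (\<phi> r)" and "r \<ge> 0"
  shows "W_phi \<phi> \<mu> \<nu> \<le> ennreal r"
proof -
  define I where "I = (INF \<gamma>\<in>couplings \<mu> \<nu>. phi_cost \<phi> \<gamma>)"
  have le: "I \<le> ennreal (\<phi> r)"
    unfolding I_def using assms(2,3) by (rule INF_lower2)
  then have fin: "I \<noteq> \<infinity>" by (auto simp: top_unique)
  have "enn2real I \<le> \<phi> r"
    using enn2real_mono[OF le] MI_nonneg[OF \<phi> \<open>r \<ge> 0\<close>] by simp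
  then have "inv_into {0..} \<phi> (enn2real I) \<le> r"
    using MI_le_iff[OF \<phi>, of "inv_into {0..} \<phi> (enn2real I)" r] MI_inv_into[OF \<phi>, of "enn2real I"] \<open>r \<ge> 0\<close>
    by simp
  then show ?thesis using fin by (simp add: W_phi_altdef phi_inv_def I_def[symmetric] ennreal_leI)
qed

lemma W_phi_less_coupling:
  assumes \<phi>: "\<phi> \<in> MI" and less: "W_phi \<phi> \<mu> \<nu> < ennreal r"
  obtains \<gamma> where "\<gamma> \<in> couplings \<mu> \<nu>" "phi_cost \<phi> \<gamma> < ennreal (\<phi> r)"
proof -
  define I where "I = (INF \<gamma>\<in>couplings \<mu> \<nu>. phi_cost \<phi> \<gamma>)"
  have "phi_inv \<phi> I < ennreal r" using less by (simp add: W_phi_altdef I_def)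
  then have fin: "I < \<top>" and "ennreal (inv_into {0..} \<phi> (enn2real I)) < ennreal r"
    by (auto simp: phi_inv_def less_top split: if_splits)
  then have "inv_into {0..} \<phi> (enn2real I) < r"
    using MI_inv_into(2)[OF \<phi>, of "enn2real I"] by (simp add: ennreal_less_iff)
  then have "enn2real I < \<phi> r"
    using MI_less_iff[OF \<phi>, of "inv_into {0..} \<phi> (enn2real I)" r] MI_inv_into(2,3)[OF \<phi>, of "enn2real I"]
    by simp
  then have "ennreal (enn2real I) < ennreal (\<phi> r)" by (simp add: ennreal_less_iff)
  then have "I < ennreal (\<phi> r)" using fin by simp
  then show ?thesis using that by (auto simp: I_def INF_less_iff)
qed

lemma borel_pair_measurable:
  fixes \<gamma> :: "('a::polish_space \<times> 'a) measure"
  assumes "sets \<gamma> = sets borel"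
  shows "fst \<in> borel_measurable \<gamma>" "snd \<in> borel_measurable \<gamma>"
    "(\<lambda>z. dist (fst z) (snd z)) \<in> borel_measurable \<gamma>"
proof -
  note borel_cong = measurable_cong_sets[OF assms refl]
  show "fst \<in> borel_measurable \<gamma>" "snd \<in> borel_measurable \<gamma>"
    "(\<lambda>z. dist (fst z) (snd z)) \<in> borel_measurable \<gamma>"
    unfolding borel_cong by (intro borel_measurable_continuous_onI continuous_intros)+
qed

lemma couplings_iff:
  fixes \<gamma> :: "('a::polish_space \<times> 'a) measure"
  shows "\<gamma> \<in> couplings \<mu> \<nu> \<longleftrightarrow> prob_space \<gamma> \<and> sets \<gamma> = sets borel \<and> distr \<gamma> borel fst = \<mu> \<and> distr \<gamma> borel snd = \<nu>"
  by (auto simp: couplings_def borel_probs_def)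

text \<open>Couplings arise below as joint laws of two random variables on some auxiliary probability
  space, and their cost is computed there.\<close>

lemma coupling_distrI:
  fixes X Y :: "'b \<Rightarrow> 'a::polish_space"
  assumes "prob_space P" and [measurable]: "X \<in> borel_measurable P" "Y \<in> borel_measurable P"
    and "\<phi> \<in> MI"
  shows "distr P borel (\<lambda>z. (X z, Y z)) \<in> couplings (distr P borel X) (distr P borel Y)"
    and "phi_cost \<phi> (distr P borel (\<lambda>z. (X z, Y z))) = (\<integral>\<^sup>+z. ennreal (\<phi> (dist (X z) (Y z))) \<partial>P)"
proof -
  have [measurable]: "(\<lambda>z. (X z, Y z)) \<in> borel_measurable P"
    by (rule borel_measurable_Pair) fact+
  note [measurable] = borel_pair_measurable[of borel]
  have [measurable]: "(\<lambda>z :: 'a \<times> 'a. \<phi> (dist (fst z) (snd z))) \<in> borel_measurable borel"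
    by (rule MI_measurable) (use assms borel_pair_measurable in auto)
  show "distr P borel (\<lambda>z. (X z, Y z)) \<in> couplings (distr P borel X) (distr P borel Y)"
    by (auto simp: couplings_iff distr_distr comp_def intro!: prob_space.prob_space_distr assms)
  show "phi_cost \<phi> (distr P borel (\<lambda>z. (X z, Y z))) = (\<integral>\<^sup>+z. ennreal (\<phi> (dist (X z) (Y z))) \<partial>P)"
    unfolding phi_cost_def by (subst nn_integral_distr) auto
qed

lemma W_phi_le_swap:
  assumes \<phi>: "\<phi> \<in> MI"
  shows "W_phi \<phi> \<mu> \<nu> \<le> W_phi \<phi> \<nu> \<mu>"
proof (rule dense_ge)
  fix x assume x: "W_phi \<phi> \<nu> \<mu> < x"
  show "W_phi \<phi> \<mu> \<nu> \<le> x"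
  proof (cases x)
    case (real r)
    obtain \<gamma> where \<gamma>: "\<gamma> \<in> couplings \<nu> \<mu>" "phi_cost \<phi> \<gamma> < ennreal (\<phi> r)"
      using W_phi_less_coupling[OF \<phi>] x real by metis
    then have s: "prob_space \<gamma>" "sets \<gamma> = sets borel" "distr \<gamma> borel fst = \<nu>" "distr \<gamma> borel snd = \<mu>"
      by (simp_all add: couplings_iff)
    note c = coupling_distrI[OF s(1) borel_pair_measurable(2)[OF s(2)] borel_pair_measurable(1)[OF s(2)] \<phi>]
    show ?thesis unfolding real(2)
    proof (rule W_phi_le[OF \<phi> _ _ real(1)])
      show "distr \<gamma> borel (\<lambda>z. (snd z, fst z)) \<in> couplings \<mu> \<nu>" using c(1) s(3,4) by simp
      show "phi_cost \<phi> (distr \<gamma> borel (\<lambda>z. (snd z, fst z))) \<le> ennreal (\<phi> r)"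
        using \<gamma>(2) unfolding c(2) by (simp add: phi_cost_def dist_commute)
    qed
  qed simp
qed

lemma W_phi_self:
  fixes \<mu> :: "'a::polish_space measure"
  assumes \<phi>: "\<phi> \<in> MI" and \<mu>: "\<mu> \<in> borel_probs"
  shows "W_phi \<phi> \<mu> \<mu> = 0"
proof -
  have s: "prob_space \<mu>" "sets \<mu> = sets borel" using \<mu> by (auto simp: borel_probs_def)
  have id: "(\<lambda>x. x) \<in> borel_measurable \<mu>" using s(2) by (simp add: measurable_ident_sets)
  have "distr \<mu> borel (\<lambda>x. x) = \<mu>" using distr_id2[of borel \<mu>] s(2) by simp
  with coupling_distrI[OF s(1) id id \<phi>] have "W_phi \<phi> \<mu> \<mu> \<le> ennreal 0"
    by (intro W_phi_le[OF \<phi>]) (auto simp: MI_0[OF \<phi>])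
  then show ?thesis by simp
qed

section \<open>The triangle inequality\<close>

text \<open>The approximate gluing: the label of an element of either coupling is the cell of its component
  in the middle space. Both labels have the law of the cell under \<open>\<mu>1\<close>, so the couplings can be
  joined along it. The slack \<open>\<epsilon>\<close> is the price for matching cells instead of points.\<close>

lemma couplings_compose_approx:
  fixes \<mu>0 \<mu>1 \<mu>2 :: "'a::polish_space measure"
  assumes \<phi>: "\<phi> \<in> MI" and \<gamma>: "\<gamma> \<in> couplings \<mu>0 \<mu>1" and \<eta>: "\<eta> \<in> couplings \<mu>1 \<mu>2"
    and pos: "s > 0" "t > 0" "\<epsilon> > 0"
    and cost: "phi_cost \<phi> \<gamma> \<le> ennreal (\<phi> s)" "phi_cost \<phi> \<eta> \<le> ennreal (\<phi> t)"
  obtains \<pi> where "\<pi> \<in> couplings \<mu>0 \<mu>2" "phi_cost \<phi> \<pi> \<le> ennreal (\<phi> (s + \<epsilon> + t))"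
proof -
  obtain k :: "'a \<Rightarrow> nat" where k[measurable]: "k \<in> borel \<rightarrow>\<^sub>M count_space UNIV"
    and cells: "\<And>x y. k x = k y \<Longrightarrow> dist x y < \<epsilon>"
    using small_cells_exist[OF pos(3)] by blast
  have g: "prob_space \<gamma>" "sets \<gamma> = sets borel" "distr \<gamma> borel fst = \<mu>0" "distr \<gamma> borel snd = \<mu>1"
    and h: "prob_space \<eta>" "sets \<eta> = sets borel" "distr \<eta> borel fst = \<mu>1" "distr \<eta> borel snd = \<mu>2"
    using \<gamma> \<eta> by (simp_all add: couplings_iff)
  note gm[measurable] = borel_pair_measurable[OF g(2)] and hm[measurable] = borel_pair_measurable[OF h(2)]
  have "emeasure \<gamma> {z \<in> space \<gamma>. k (snd z) = i} = emeasure \<eta> {z \<in> space \<eta>. k (fst z) = i}" for i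
  proof -
    have "emeasure \<gamma> {z \<in> space \<gamma>. k (snd z) = i} = emeasure (distr \<gamma> borel snd) {x. k x = i}"
      by (subst emeasure_distr) (auto simp: vimage_def intro!: arg_cong[of _ _ "emeasure \<gamma>"])
    also have "distr \<gamma> borel snd = distr \<eta> borel fst" using g h by simp
    also have "emeasure \<dots> {x. k x = i} = emeasure \<eta> {z \<in> space \<eta>. k (fst z) = i}"
      by (subst emeasure_distr) (auto simp: vimage_def intro!: arg_cong[of _ _ "emeasure \<eta>"])
    finally show ?thesis .
  qed
  then obtain P where P: "prob_space P" and setsP[measurable_cong]: "sets P = sets (\<gamma> \<Otimes>\<^sub>M \<eta>)"
    and Pfst: "distr P \<gamma> fst = \<gamma>" and Psnd: "distr P \<eta> snd = \<eta>"
    and same: "AE z in P. k (snd (fst z)) = k (fst (snd z))"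
    using couple_along_countable_label[OF g(1) h(1), of "\<lambda>z. k (snd z)" "\<lambda>z. k (fst z)"] by auto
  interpret P: prob_space P by fact
  define X where "X = (\<lambda>z :: ('a \<times> 'a) \<times> ('a \<times> 'a). fst (fst z))"
  define Y where "Y = (\<lambda>z :: ('a \<times> 'a) \<times> ('a \<times> 'a). snd (snd z))"
  define f where "f z = dist (fst (fst z)) (snd (fst z))" for z :: "('a \<times> 'a) \<times> ('a \<times> 'a)"
  define g where "g z = dist (fst (snd z)) (snd (snd z))" for z :: "('a \<times> 'a) \<times> ('a \<times> 'a)"
  have [measurable]: "X \<in> borel_measurable P" "Y \<in> borel_measurable P"
    unfolding X_def Y_def by measurable
  have [measurable]: "f \<in> borel_measurable P" "g \<in> borel_measurable P"
    unfolding f_def g_def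
    using measurable_compose[OF _ gm(3), of fst P] measurable_compose[OF _ hm(3), of snd P] by auto
  have [simp]: "f z \<ge> 0" "g z \<ge> 0" for z by (simp_all add: f_def g_def)
  have "(\<integral>\<^sup>+z. ennreal (\<phi> (f z)) \<partial>P) = phi_cost \<phi> (distr P \<gamma> fst)"
    unfolding phi_cost_def using MI_measurable[OF \<phi> gm(3)]
    by (subst nn_integral_distr) (auto simp: f_def)
  with cost have f: "(\<integral>\<^sup>+z. ennreal (\<phi> (f z)) \<partial>P) \<le> ennreal (\<phi> s)" by (simp add: Pfst)
  have "(\<integral>\<^sup>+z. ennreal (\<phi> (g z)) \<partial>P) = phi_cost \<phi> (distr P \<eta> snd)"
    unfolding phi_cost_def using MI_measurable[OF \<phi> hm(3)]
    by (subst nn_integral_distr) (auto simp: g_def)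
  with cost have g': "(\<integral>\<^sup>+z. ennreal (\<phi> (g z)) \<partial>P) \<le> ennreal (\<phi> t)" by (simp add: Psnd)
  have "(\<integral>\<^sup>+z. ennreal (\<phi> (f z + \<epsilon>)) \<partial>P) \<le> ennreal (\<phi> (s + \<epsilon>))"
    using pos f by (intro P.MI_Minkowski[OF \<phi>]) (auto simp: P.emeasure_space_1)
  then have total: "(\<integral>\<^sup>+z. ennreal (\<phi> (f z + \<epsilon> + g z)) \<partial>P) \<le> ennreal (\<phi> (s + \<epsilon> + t))"
    using pos g' by (intro P.MI_Minkowski[OF \<phi>, of "s + \<epsilon>" t "\<lambda>z. f z + \<epsilon>" g]) auto
  have "(\<integral>\<^sup>+z. ennreal (\<phi> (dist (X z) (Y z))) \<partial>P) \<le> (\<integral>\<^sup>+z. ennreal (\<phi> (f z + \<epsilon> + g z)) \<partial>P)"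
  proof (rule nn_integral_mono_AE, use same in eventually_elim)
    fix z :: "('a \<times> 'a) \<times> ('a \<times> 'a)" assume "k (snd (fst z)) = k (fst (snd z))"
    from cells[OF this] have "dist (X z) (Y z) \<le> f z + \<epsilon> + g z"
      using dist_triangle[of "X z" "Y z" "snd (fst z)"]
        dist_triangle[of "snd (fst z)" "Y z" "fst (snd z)"]
      by (simp add: X_def Y_def f_def g_def)
    then show "ennreal (\<phi> (dist (X z) (Y z))) \<le> ennreal (\<phi> (f z + \<epsilon> + g z))"
      using pos by (intro ennreal_leI) (simp add: MI_le_iff[OF \<phi>])
  qed
  with total have bound: "phi_cost \<phi> (distr P borel (\<lambda>z. (X z, Y z))) \<le> ennreal (\<phi> (s + \<epsilon> + t))"
    by (subst coupling_distrI(2)[OF P _ _ \<phi>]) auto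
  have "distr P borel X = distr (distr P \<gamma> fst) borel fst"
    by (subst distr_distr) (auto simp: X_def comp_def)
  moreover have "distr P borel Y = distr (distr P \<eta> snd) borel snd"
    by (subst distr_distr) (auto simp: Y_def comp_def)
  ultimately have "distr P borel (\<lambda>z. (X z, Y z)) \<in> couplings \<mu>0 \<mu>2"
    using coupling_distrI(1)[OF P, of X Y \<phi>] \<phi> \<open>distr \<gamma> borel fst = \<mu>0\<close> h by (simp add: Pfst Psnd)
  with bound that show ?thesis by blast
qed

lemma W_phi_triangle:
  fixes \<mu>0 \<mu>1 \<mu>2 :: "'a::polish_space measure"
  assumes \<phi>: "\<phi> \<in> MI" and fin: "W_phi \<phi> \<mu>0 \<mu>1 < \<top>" "W_phi \<phi> \<mu>1 \<mu>2 < \<top>"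
  shows "W_phi \<phi> \<mu>0 \<mu>2 \<le> W_phi \<phi> \<mu>0 \<mu>1 + W_phi \<phi> \<mu>1 \<mu>2"
proof (rule ennreal_le_epsilon)
  fix e :: real assume "e > 0"
  obtain s where s: "s \<ge> 0" "W_phi \<phi> \<mu>0 \<mu>1 = ennreal s" using fin(1) by (auto simp: less_top_ennreal)
  obtain t where t: "t \<ge> 0" "W_phi \<phi> \<mu>1 \<mu>2 = ennreal t" using fin(2) by (auto simp: less_top_ennreal)
  \<comment> \<open>The error \<open>e\<close> is spent in thirds: one for each almost optimal coupling, one for the gluing.\<close>
  have e: "e / 3 > 0" using \<open>e > 0\<close> by simp
  have "W_phi \<phi> \<mu>0 \<mu>1 < ennreal (s + e / 3)" "W_phi \<phi> \<mu>1 \<mu>2 < ennreal (t + e / 3)"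
    using s t e by (simp_all add: ennreal_less_iff del: ennreal_plus)
  then obtain \<gamma> \<eta> where "\<gamma> \<in> couplings \<mu>0 \<mu>1" "phi_cost \<phi> \<gamma> < ennreal (\<phi> (s + e / 3))"
    and "\<eta> \<in> couplings \<mu>1 \<mu>2" "phi_cost \<phi> \<eta> < ennreal (\<phi> (t + e / 3))"
    using W_phi_less_coupling[OF \<phi>] by metis
  then obtain \<pi> where "\<pi> \<in> couplings \<mu>0 \<mu>2"
    and "phi_cost \<phi> \<pi> \<le> ennreal (\<phi> ((s + e / 3) + e / 3 + (t + e / 3)))"
    using couplings_compose_approx[OF \<phi>, of \<gamma> \<mu>0 \<mu>1 \<eta> \<mu>2 "s + e / 3" "t + e / 3" "e / 3"] s t e
    by (auto simp: less_imp_le)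
  then have "W_phi \<phi> \<mu>0 \<mu>2 \<le> ennreal ((s + e / 3) + e / 3 + (t + e / 3))"
    using s t e by (intro W_phi_le[OF \<phi>]) auto
  also have "\<dots> = W_phi \<phi> \<mu>0 \<mu>1 + W_phi \<phi> \<mu>1 \<mu>2 + ennreal e"
    using s t \<open>e > 0\<close> by (simp add: ennreal_plus[symmetric] del: ennreal_plus)
  finally show "W_phi \<phi> \<mu>0 \<mu>2 \<le> W_phi \<phi> \<mu>0 \<mu>1 + W_phi \<phi> \<mu>1 \<mu>2 + ennreal e" .
qed

section \<open>Measures at distance zero\<close>

text \<open>Under a coupling whose cost is at most \<open>\<phi> r * r\<close>, Markov's inequality bounds the probability
  that a point is moved by \<open>r\<close> or more by \<open>r\<close>. All other points of \<open>C\<close> end up in its closed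
  \<open>r\<close>-neighbourhood.\<close>

lemma coupling_closed_set_bound:
  fixes \<mu> \<nu> :: "'a::polish_space measure"
  assumes \<phi>: "\<phi> \<in> MI" and \<gamma>: "\<gamma> \<in> couplings \<mu> \<nu>" and r: "r > 0"
    and cost: "phi_cost \<phi> \<gamma> \<le> ennreal (\<phi> r * r)" and C: "closed C" "C \<noteq> {}"
  shows "measure \<mu> C \<le> measure \<nu> {y. infdist y C \<le> r} + r"
proof -
  have g: "prob_space \<gamma>" "sets \<gamma> = sets borel" "distr \<gamma> borel fst = \<mu>" "distr \<gamma> borel snd = \<nu>"
    using \<gamma> by (simp_all add: couplings_iff)
  interpret prob_space \<gamma> by fact
  note [measurable] = borel_pair_measurable[OF g(2)]
  define d where "d z = \<phi> (dist (fst z) (snd z))" for z :: "'a \<times> 'a"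
  have d[measurable]: "d \<in> borel_measurable \<gamma>"
    unfolding d_def by (rule MI_measurable[OF \<phi>]) auto
  have pr: "\<phi> r > 0" using MI_pos[OF \<phi> r] .
  have [measurable]: "C \<in> sets borel" using C by simp
  have [measurable]: "{y. infdist y C \<le> r} \<in> sets borel"
    by (intro borel_closed closed_Collect_le continuous_intros)
  have "(\<lambda>y. infdist y C) \<in> borel_measurable borel"
    by (intro borel_measurable_continuous_onI continuous_intros)
  from measurable_compose[OF borel_pair_measurable(2)[OF g(2)] this]
  have [measurable]: "(\<lambda>z. infdist (snd z) C) \<in> borel_measurable \<gamma>" .
  have markov: "emeasure \<gamma> {z \<in> space \<gamma>. \<phi> r \<le> d z} \<le> ennreal r"
  proof -
    have "{z \<in> space \<gamma>. \<phi> r \<le> d z} = {z \<in> space \<gamma>. 1 \<le> ennreal (1 / \<phi> r) * ennreal (d z)}"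
      using pr MI_nonneg[OF \<phi>] by (auto simp: ennreal_mult[symmetric] d_def field_simps)
    also have "emeasure \<gamma> \<dots> \<le> ennreal (1 / \<phi> r) * (\<integral>\<^sup>+z. ennreal (d z) * indicator (space \<gamma>) z \<partial>\<gamma>)"
      by (rule nn_integral_Markov_inequality) auto
    also have "(\<integral>\<^sup>+z. ennreal (d z) * indicator (space \<gamma>) z \<partial>\<gamma>) = phi_cost \<phi> \<gamma>"
      unfolding phi_cost_def by (intro nn_integral_cong) (simp add: d_def)
    also have "ennreal (1 / \<phi> r) * phi_cost \<phi> \<gamma> \<le> ennreal (1 / \<phi> r) * ennreal (\<phi> r * r)"
      by (intro mult_left_mono cost) simp
    also have "\<dots> = ennreal r" using pr r by (simp add: ennreal_mult[symmetric])
    finally show ?thesis .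
  qed
  have "measure \<mu> C = measure \<gamma> {z \<in> space \<gamma>. fst z \<in> C}"
    unfolding g(3)[symmetric]
    by (subst measure_distr) (auto simp: vimage_def intro!: arg_cong[of _ _ "measure \<gamma>"])
  also have "\<dots> \<le> measure \<gamma> ({z \<in> space \<gamma>. infdist (snd z) C \<le> r} \<union> {z \<in> space \<gamma>. \<phi> r \<le> d z})"
  proof (rule finite_measure_mono)
    show "{z \<in> space \<gamma>. fst z \<in> C} \<subseteq> {z \<in> space \<gamma>. infdist (snd z) C \<le> r} \<union> {z \<in> space \<gamma>. \<phi> r \<le> d z}"
    proof safe
      fix z assume "fst z \<in> C" "\<not> \<phi> r \<le> d z"
      then have "dist (snd z) (fst z) \<le> r"
        using r by (simp add: d_def MI_le_iff[OF \<phi>] dist_commute)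
      with infdist_le[OF \<open>fst z \<in> C\<close>] show "infdist (snd z) C \<le> r" by (rule order_trans)
    qed
  qed auto
  also have "\<dots> \<le> measure \<gamma> {z \<in> space \<gamma>. infdist (snd z) C \<le> r} + measure \<gamma> {z \<in> space \<gamma>. \<phi> r \<le> d z}"
    by (rule measure_Un_le) auto
  also have "measure \<gamma> {z \<in> space \<gamma>. infdist (snd z) C \<le> r} = measure \<nu> {y. infdist y C \<le> r}"
    unfolding g(4)[symmetric]
    by (subst measure_distr) (auto simp: vimage_def intro!: arg_cong[of _ _ "measure \<gamma>"])
  also have "measure \<gamma> {z \<in> space \<gamma>. \<phi> r \<le> d z} \<le> r"
    using markov r by (simp add: emeasure_eq_measure)
  finally show ?thesis by simp
qed

text \<open>Closed neighbourhoods of a closed set decrease to the set itself.\<close>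

lemma W_phi_zero_closed_le:
  fixes \<mu> \<nu> :: "'a::polish_space measure"
  assumes \<phi>: "\<phi> \<in> MI" and \<nu>: "\<nu> \<in> borel_probs" and W: "W_phi \<phi> \<mu> \<nu> = 0" and C: "closed C"
  shows "measure \<mu> C \<le> measure \<nu> C"
proof (cases "C = {}")
  case False
  interpret \<nu>: prob_space \<nu> using \<nu> by (simp add: borel_probs_def)
  have sets: "sets \<nu> = sets borel" using \<nu> by (simp add: borel_probs_def)
  define r where "r n = 1 / real (Suc n)" for n
  have r: "r n > 0" for n by (simp add: r_def)
  have bound: "measure \<mu> C \<le> measure \<nu> {y. infdist y C \<le> r n} + r n" for n
  proof -
    define c where "c = \<phi> (r n) * r n"
    have "c > 0" using r[of n] MI_pos[OF \<phi>] by (simp add: c_def)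
    \<comment> \<open>The cost bound \<open>c\<close> corresponds to distance \<open>q\<close>.\<close>
    define q where "q = inv_into {0..} \<phi> c"
    have q: "q \<ge> 0" "\<phi> q = c" using MI_inv_into[OF \<phi>, of c] \<open>c > 0\<close> by (auto simp: q_def)
    then have "q \<noteq> 0" using MI_0[OF \<phi>] \<open>c > 0\<close> by auto
    then have "W_phi \<phi> \<mu> \<nu> < ennreal q" using W q by simp
    then obtain \<gamma> where "\<gamma> \<in> couplings \<mu> \<nu>" "phi_cost \<phi> \<gamma> < ennreal c"
      using W_phi_less_coupling[OF \<phi>] q by metis
    then show ?thesis
      using coupling_closed_set_bound[OF \<phi> _ r _ C False] by (auto simp: c_def)
  qed
  have "(\<lambda>n. measure \<nu> {y. infdist y C \<le> r n}) \<longlonglongrightarrow> measure \<nu> (\<Inter>n. {y. infdist y C \<le> r n})"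
  proof (rule \<nu>.finite_Lim_measure_decseq)
    have "closed {y. infdist y C \<le> c}" for c
      by (intro closed_Collect_le continuous_intros)
    then show "range (\<lambda>n. {y. infdist y C \<le> r n}) \<subseteq> sets \<nu>" by (auto simp: sets)
    show "decseq (\<lambda>n. {y. infdist y C \<le> r n})"
      by (auto simp: decseq_def r_def frac_le intro: order_trans)
  qed
  moreover have "r \<longlonglongrightarrow> 0"
    unfolding r_def by (rule LIMSEQ_Suc[OF lim_1_over_n])
  ultimately have lim: "(\<lambda>n. measure \<nu> {y. infdist y C \<le> r n} + r n)
      \<longlonglongrightarrow> measure \<nu> (\<Inter>n. {y. infdist y C \<le> r n}) + 0"
    by (intro tendsto_add)
  have "(\<Inter>n. {y. infdist y C \<le> r n}) = C"
  proof safe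
    fix y assume y: "y \<in> (\<Inter>n. {y. infdist y C \<le> r n})"
    have "infdist y C \<le> 0"
      by (rule LIMSEQ_le_const[OF \<open>r \<longlonglongrightarrow> 0\<close>]) (use y in auto)
    then show "y \<in> C" using in_closed_iff_infdist_zero[OF C False] infdist_nonneg[of y C] by simp
  next
    fix y n assume "y \<in> C"
    then show "infdist y C \<le> r n" using r[of n] by simp
  qed
  with LIMSEQ_le_const[OF lim] bound show ?thesis by simp
qed simp

lemma W_phi_zero_imp_eq:
  fixes \<mu> \<nu> :: "'a::polish_space measure"
  assumes \<phi>: "\<phi> \<in> MI" and \<mu>: "\<mu> \<in> borel_probs" and \<nu>: "\<nu> \<in> borel_probs" and W: "W_phi \<phi> \<mu> \<nu> = 0"
  shows "\<mu> = \<nu>"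
proof -
  interpret \<mu>: prob_space \<mu> using \<mu> by (simp add: borel_probs_def)
  interpret \<nu>: prob_space \<nu> using \<nu> by (simp add: borel_probs_def)
  have sets: "sets \<mu> = sigma_sets UNIV (Collect closed)" "sets \<nu> = sigma_sets UNIV (Collect closed)"
    using \<mu> \<nu> by (simp_all add: borel_probs_def borel_eq_closed)
  have W': "W_phi \<phi> \<nu> \<mu> = 0" using W_phi_le_swap[OF \<phi>, of \<nu> \<mu>] W by simp
  show ?thesis
  proof (rule measure_eqI_generator_eq[where A="\<lambda>_. UNIV", OF _ _ _ sets])
    show "Int_stable (Collect closed :: 'a set set)" by (auto simp: Int_stable_def)
    fix C :: "'a set" assume "C \<in> Collect closed"
    then have "measure \<mu> C = measure \<nu> C"
      using W_phi_zero_closed_le[OF \<phi> \<nu> W] W_phi_zero_closed_le[OF \<phi> \<mu> W'] by (auto intro: antisym)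
    then show "emeasure \<mu> C = emeasure \<nu> C"
      by (simp add: \<mu>.emeasure_eq_measure \<nu>.emeasure_eq_measure)
  qed auto
qed

section \<open>Integrability and finiteness\<close>

lemma nn_integral_le_phi:
  assumes \<phi>: "\<phi> \<in> MI" and "I < \<infinity>"
  obtains s where "s > 0" "I \<le> ennreal (\<phi> s)"
proof -
  define e where "e = enn2real I"
  define s where "s = inv_into {0..} \<phi> e + 1"
  have "e \<ge> 0" by (simp add: e_def)
  then have "\<phi> (inv_into {0..} \<phi> e) \<le> \<phi> s"
    using MI_inv_into[OF \<phi>, of e] by (subst MI_le_iff[OF \<phi>]) (auto simp: s_def)
  then have "e \<le> \<phi> s" using MI_inv_into[OF \<phi> \<open>e \<ge> 0\<close>] by simp
  moreover have "I = ennreal e" using \<open>I < \<infinity>\<close> by (simp add: e_def)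
  moreover have "s > 0" using MI_inv_into[OF \<phi> \<open>e \<ge> 0\<close>] by (simp add: s_def)
  ultimately show ?thesis using that[of s] by (simp add: ennreal_leI)
qed

lemma borel_probs_dist_measurable:
  fixes \<mu> :: "'a::polish_space measure"
  assumes "\<mu> \<in> borel_probs"
  shows "(\<lambda>x. dist x y) \<in> borel_measurable \<mu>"
proof -
  have sets: "sets \<mu> = sets borel" using assms by (simp add: borel_probs_def)
  show ?thesis
    unfolding measurable_cong_sets[OF sets refl]
    by (intro borel_measurable_continuous_onI continuous_intros)
qed

text \<open>Apply Minkowski's inequality to \<open>dist x z \<le> dist x y + dist y z\<close>, whose second term is constant.\<close>

lemma moment_change_base:
  fixes \<mu> :: "'a::polish_space measure"
  assumes \<phi>: "\<phi> \<in> MI" and \<mu>: "\<mu> \<in> borel_probs"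
    and fin: "(\<integral>\<^sup>+x. ennreal (\<phi> (dist x y)) \<partial>\<mu>) < \<infinity>"
  shows "(\<integral>\<^sup>+x. ennreal (\<phi> (dist x z)) \<partial>\<mu>) < \<infinity>"
proof -
  interpret prob_space \<mu> using \<mu> by (simp add: borel_probs_def)
  obtain s where "s > 0" "(\<integral>\<^sup>+x. ennreal (\<phi> (dist x y)) \<partial>\<mu>) \<le> ennreal (\<phi> s)"
    using nn_integral_le_phi[OF \<phi> fin] .
  \<comment> \<open>The summand \<open>1\<close> makes \<open>t\<close> positive also if \<open>y = z\<close>.\<close>
  define t where "t = dist y z + 1"
  have t: "t > 0" "dist y z \<le> t" using zero_le_dist[of y z] by (auto simp: t_def simp del: zero_le_dist)
  have "(\<integral>\<^sup>+x. ennreal (\<phi> (dist x z)) \<partial>\<mu>) \<le> (\<integral>\<^sup>+x. ennreal (\<phi> (dist x y + t)) \<partial>\<mu>)"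
  proof (intro nn_integral_mono ennreal_leI)
    fix x show "\<phi> (dist x z) \<le> \<phi> (dist x y + t)"
      using dist_triangle[of x z y] t by (simp add: MI_le_iff[OF \<phi>])
  qed
  also have "\<dots> \<le> ennreal (\<phi> (s + t))"
    by (intro MI_Minkowski[OF \<phi>] \<open>s > 0\<close> t borel_probs_dist_measurable[OF \<mu>])
      (use t \<open>_ \<le> ennreal (\<phi> s)\<close> in \<open>auto simp: emeasure_space_1\<close>)
  finally show ?thesis by (simp add: order_le_less_trans)
qed

lemma distr_pair_snd:
  assumes "prob_space M" "sigma_finite_measure N"
  shows "distr (M \<Otimes>\<^sub>M N) N snd = N"
proof (rule measure_eqI)
  interpret M: prob_space M by fact
  interpret N: sigma_finite_measure N by fact
  fix A assume "A \<in> sets (distr (M \<Otimes>\<^sub>M N) N snd)"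
  then have A: "A \<in> sets N" by simp
  then have "snd -` A \<inter> space (M \<Otimes>\<^sub>M N) = space M \<times> A"
    using sets.sets_into_space by (auto simp: space_pair_measure)
  with A show "emeasure (distr (M \<Otimes>\<^sub>M N) N snd) A = emeasure N A"
    by (simp add: emeasure_distr N.emeasure_pair_measure_Times M.emeasure_space_1)
qed simp

text \<open>The independent coupling has finite cost by Minkowski's inequality, applied to the two distances
  from the base point.\<close>

lemma W_phi_finite:
  fixes \<mu> \<nu> :: "'a::polish_space measure"
  assumes \<phi>: "\<phi> \<in> MI" and \<mu>: "\<mu> \<in> borel_probs" and \<nu>: "\<nu> \<in> borel_probs"
    and fin: "(\<integral>\<^sup>+x. ennreal (\<phi> (dist x y)) \<partial>\<mu>) < \<infinity>" "(\<integral>\<^sup>+x. ennreal (\<phi> (dist x y)) \<partial>\<nu>) < \<infinity>"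
  shows "W_phi \<phi> \<mu> \<nu> < \<infinity>"
proof -
  interpret \<mu>: prob_space \<mu> using \<mu> by (simp add: borel_probs_def)
  interpret \<nu>: prob_space \<nu> using \<nu> by (simp add: borel_probs_def)
  interpret P: prob_space "\<mu> \<Otimes>\<^sub>M \<nu>" by (rule prob_space_pair) unfold_locales
  let ?P = "\<mu> \<Otimes>\<^sub>M \<nu>"
  have sets[measurable_cong]: "sets \<mu> = sets borel" "sets \<nu> = sets borel"
    using \<mu> \<nu> by (simp_all add: borel_probs_def)
  obtain s where s: "s > 0" "(\<integral>\<^sup>+x. ennreal (\<phi> (dist x y)) \<partial>\<mu>) \<le> ennreal (\<phi> s)"
    using nn_integral_le_phi[OF \<phi> fin(1)] .
  obtain t where t: "t > 0" "(\<integral>\<^sup>+x. ennreal (\<phi> (dist x y)) \<partial>\<nu>) \<le> ennreal (\<phi> t)"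
    using nn_integral_le_phi[OF \<phi> fin(2)] .
  have X: "fst \<in> borel_measurable ?P" and Y: "snd \<in> borel_measurable ?P" by measurable
  note [measurable] = borel_probs_dist_measurable[OF \<mu>, of y] borel_probs_dist_measurable[OF \<nu>, of y]
  note [measurable] = MI_measurable[OF \<phi> borel_probs_dist_measurable[OF \<mu>, of y]]
    MI_measurable[OF \<phi> borel_probs_dist_measurable[OF \<nu>, of y]]
  have fst: "distr ?P \<mu> fst = \<mu>" by (rule \<nu>.distr_pair_fst)
  have snd: "distr ?P \<nu> snd = \<nu>"
    by (rule distr_pair_snd) unfold_locales
  have "distr ?P borel fst = distr ?P \<mu> fst" "distr ?P borel snd = distr ?P \<nu> snd"
    using sets by (auto intro!: distr_cong)
  with coupling_distrI(1)[OF P.prob_space_axioms X Y \<phi>] fst snd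
  have coup: "distr ?P borel (\<lambda>z. (fst z, snd z)) \<in> couplings \<mu> \<nu>" by simp
  have "phi_cost \<phi> (distr ?P borel (\<lambda>z. (fst z, snd z))) = (\<integral>\<^sup>+z. ennreal (\<phi> (dist (fst z) (snd z))) \<partial>?P)"
    by (rule coupling_distrI(2)[OF P.prob_space_axioms X Y \<phi>])
  also have "\<dots> \<le> (\<integral>\<^sup>+z. ennreal (\<phi> (dist (fst z) y + dist (snd z) y)) \<partial>?P)"
    by (intro nn_integral_mono ennreal_leI) (simp add: MI_le_iff[OF \<phi>] dist_triangle2)
  also have "\<dots> \<le> ennreal (\<phi> (s + t))"
  proof (intro P.MI_Minkowski[OF \<phi>] s(1) t(1))
    have "(\<integral>\<^sup>+z. ennreal (\<phi> (dist (fst z) y)) \<partial>?P) = (\<integral>\<^sup>+x. ennreal (\<phi> (dist x y)) \<partial>distr ?P \<mu> fst)"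
      by (subst nn_integral_distr) auto
    then show "(\<integral>\<^sup>+z. ennreal (\<phi> (dist (fst z) y)) \<partial>?P) \<le> ennreal (\<phi> s)" using s by (simp add: fst)
    have "(\<integral>\<^sup>+z. ennreal (\<phi> (dist (snd z) y)) \<partial>?P) = (\<integral>\<^sup>+x. ennreal (\<phi> (dist x y)) \<partial>distr ?P \<nu> snd)"
      by (subst nn_integral_distr) auto
    then show "(\<integral>\<^sup>+z. ennreal (\<phi> (dist (snd z) y)) \<partial>?P) \<le> ennreal (\<phi> t)" using t by (simp add: snd)
  qed auto
  finally have "W_phi \<phi> \<mu> \<nu> \<le> ennreal (s + t)"
    using s t by (intro W_phi_le[OF \<phi> coup]) auto
  then show ?thesis by (simp add: order_le_less_trans)
qed

section \<open>The metric\<close>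

theorem lemma3p6:
  fixes \<phi> :: "real \<Rightarrow> real"
  assumes "\<phi> \<in> MI"
  shows "(\<forall>y :: 'a::polish_space.
            P_phi \<phi> = {\<mu> \<in> borel_probs. (\<integral>\<^sup>+ x. ennreal (\<phi> (dist x y)) \<partial>\<mu>) < \<infinity>})
       \<and> (\<forall>\<mu>0 \<in> P_phi \<phi>. \<forall>\<mu>1 \<in> (P_phi \<phi> :: 'a measure set). W_phi \<phi> \<mu>0 \<mu>1 < \<infinity>)
       \<and> Metric_space (P_phi \<phi> :: 'a measure set) (\<lambda>\<mu>0 \<mu>1. enn2real (W_phi \<phi> \<mu>0 \<mu>1))"
proof (intro conjI)
  note \<phi> = assms
  show base: "\<forall>y :: 'a. P_phi \<phi> = {\<mu> \<in> borel_probs. (\<integral>\<^sup>+ x. ennreal (\<phi> (dist x y)) \<partial>\<mu>) < \<infinity>}"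
    using moment_change_base[OF \<phi>] unfolding P_phi_def by blast
  show fin: "\<forall>\<mu>0 \<in> P_phi \<phi>. \<forall>\<mu>1 \<in> (P_phi \<phi> :: 'a measure set). W_phi \<phi> \<mu>0 \<mu>1 < \<infinity>"
    using W_phi_finite[OF \<phi>] base by blast
  show "Metric_space (P_phi \<phi> :: 'a measure set) (\<lambda>\<mu>0 \<mu>1. enn2real (W_phi \<phi> \<mu>0 \<mu>1))"
  proof
    fix \<mu> \<nu> :: "'a measure"
    show "0 \<le> enn2real (W_phi \<phi> \<mu> \<nu>)" by simp
    show "enn2real (W_phi \<phi> \<mu> \<nu>) = enn2real (W_phi \<phi> \<nu> \<mu>)"
      using W_phi_le_swap[OF \<phi>, of \<mu> \<nu>] W_phi_le_swap[OF \<phi>, of \<nu> \<mu>] by simp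
  next
    fix \<mu> \<nu> :: "'a measure" assume "\<mu> \<in> P_phi \<phi>" "\<nu> \<in> P_phi \<phi>"
    moreover from this have "\<mu> \<in> borel_probs" "\<nu> \<in> borel_probs" by (auto simp: P_phi_def)
    moreover have "W_phi \<phi> \<mu> \<nu> < \<infinity>" using calculation fin by blast
    ultimately show "enn2real (W_phi \<phi> \<mu> \<nu>) = 0 \<longleftrightarrow> \<mu> = \<nu>"
      using W_phi_zero_imp_eq[OF \<phi>] W_phi_self[OF \<phi>] by (auto simp: enn2real_eq_0_iff)
  next
    fix \<mu> \<nu> \<kappa> :: "'a measure" assume "\<mu> \<in> P_phi \<phi>" "\<nu> \<in> P_phi \<phi>" "\<kappa> \<in> P_phi \<phi>"
    then have fin': "W_phi \<phi> \<mu> \<nu> < \<top>" "W_phi \<phi> \<nu> \<kappa> < \<top>" using fin by auto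
    have "enn2real (W_phi \<phi> \<mu> \<kappa>) \<le> enn2real (W_phi \<phi> \<mu> \<nu> + W_phi \<phi> \<nu> \<kappa>)"
      using W_phi_triangle[OF \<phi> fin'] fin' by (intro enn2real_mono) (auto simp: ennreal_add_less_top)
    also have "\<dots> = enn2real (W_phi \<phi> \<mu> \<nu>) + enn2real (W_phi \<phi> \<nu> \<kappa>)"
      using fin' by (rule enn2real_plus)
    finally show "enn2real (W_phi \<phi> \<mu> \<kappa>) \<le> enn2real (W_phi \<phi> \<mu> \<nu>) + enn2real (W_phi \<phi> \<nu> \<kappa>)" .
  qed
qed

end
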